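(* Let $\theta\in(0,\pi)$ and let $\nu,\mu\in\mathbb{C}$ be such that $\nu+\mu\notin\{-1,-2,-3,\dots\}$. Consider the series \[ S=\sum_{k=0}^\infty \frac{\Gamma(\nu+\mu+k+1)}{\Gamma(\nu+k+\frac32)}\,\frac{(\mu+\frac12)_k}{k!}\, \sin((\nu+\mu+2k+1)\theta). \] (a) If $\Re\mu<0$, then the series $S$ converges absolutely. (b) If $0\le\Re\mu<\frac12$, then the series $S$ converges, but, if $\theta\neq\frac12\pi$, it does not converge absolutely. (c) If $\Re\mu\ge\frac12$ and $\theta\neq\frac12\pi$, then the series $S$ diverges.
   Context: Here $(a)_k=a(a+1)\cdots(a+k-1)$, $(a)_0=1$, is the Pochhammer symbol, and $1/\Gamma(z)$ is the entire reciprocal gamma function (equal to $0$ at $z=0,-1,-2,\dots$). Convergence means convergence of the sequence of partial sums in $\mathbb{C}$. *)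

theory Defs
  imports "HOL-Analysis.Analysis"
begin

(* The quotient by Gamma(\<nu>+k+3/2) is written with the entire function rGamma, so it is 0
   when \<nu>+k+3/2 is a pole of Gamma. *)
definition S_term :: "complex \<Rightarrow> complex \<Rightarrow> real \<Rightarrow> nat \<Rightarrow> complex" where
  "S_term \<nu> \<mu> \<theta> k =
     Gamma (\<nu> + \<mu> + of_nat k + 1) * rGamma (\<nu> + of_nat k + 3/2)
     * (pochhammer (\<mu> + 1/2) k / fact k)
     * sin ((\<nu> + \<mu> + 2 * of_nat k + 1) * of_real \<theta>)"

end

theory Submission
  imports Defs
begin

text \<open>
  The \<open>k\<close>-th term is a coefficient \<open>c\<^sub>k\<close> times the sine \<open>s\<^sub>k\<close> of \<open>(\<nu> + \<mu> + 2k + 1) \<theta>\<close>, and the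
  coefficients behave like a power: \<open>c\<^sub>k k powr (1 - 2\<mu>)\<close> tends to \<open>1 / \<Gamma>(\<mu> + 1/2)\<close>
  (\<open>S_coeff_asymp\<close>), so \<open>|c\<^sub>k|\<close> has size \<open>k powr (2 Re \<mu> - 1)\<close> unless \<open>\<mu> + 1/2\<close> is a pole of
  \<open>\<Gamma>\<close>, which is impossible for \<open>Re \<mu> \<ge> 0\<close>. All three Gamma-type factors are controlled by the one
  limit \<open>rGamma_shift_asymp\<close>. The imaginary part of the argument of \<open>s\<^sub>k\<close> does not depend on \<open>k\<close>,
  hence the sines are bounded, and absolute convergence for \<open>Re \<mu> < 0\<close> is a comparison with a
  \<open>p\<close>-series.

  For \<open>Re \<mu> < 1/2\<close> convergence is Dirichlet's test. The partial sums of \<open>s\<^sub>k\<close> stay bounded because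
  \<open>sin \<theta> \<noteq> 0\<close> (\<open>S_sine_bounded_primitive\<close>), and \<open>c\<^sub>k\<close> tends to \<open>0\<close> with bounded variation. As the
  coefficients are complex, monotonicity is not available; instead the rational function
  \<open>c\<^sub>k\<^sub>+\<^sub>1 / c\<^sub>k\<close> shows that \<open>c\<^sub>k\<^sub>+\<^sub>1 - c\<^sub>k\<close> is at most of order \<open>k powr (2 Re \<mu> - 2)\<close>, which is
  summable (\<open>S_coeff_diff_asymp\<close>).

  The negative statements rest on the fact that two consecutive sines cannot both be small when
  \<open>sin 2\<theta> \<noteq> 0\<close>, that is, when \<open>\<theta> \<noteq> \<pi>/2\<close> (\<open>S_sine_pair_lower_bound\<close>). For \<open>Re \<mu> \<ge> 0\<close> and large
  \<open>k\<close> the bound \<open>|c\<^sub>k| \<ge> \<delta>/k\<close> holds for some \<open>\<delta> > 0\<close>, so absolute convergence would make the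
  harmonic series converge; for \<open>Re \<mu> \<ge> 1/2\<close> even \<open>|c\<^sub>k| \<ge> \<delta>\<close>, so the terms do not tend to \<open>0\<close>.
\<close>

section \<open>Asymptotics of the coefficients\<close>

lemma norm_of_nat_powr: "norm (of_nat n powr z :: complex) = real n powr Re z"
  by (cases "n = 0") (simp_all add: powr_def Ln_of_nat mult.commute)

text \<open>
  This is Gauss's product formula \<open>rGamma_series_LIMSEQ\<close> in disguise: the recurrence turns the
  Pochhammer symbol in the product into the quotient of \<open>rGamma z\<close> and \<open>rGamma (z + n)\<close>. Cancelling
  \<open>rGamma z\<close> requires that \<open>z\<close> is not one of its zeros.
\<close>

lemma rGamma_shift_asymp_regular:
  fixes z :: complex
  assumes "z \<notin> \<int>\<^sub>\<le>\<^sub>0"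
  shows "(\<lambda>n. rGamma (z + of_nat n) * fact n * of_nat n powr (z - 1)) \<longlonglongrightarrow> 1"
proof -
  have nz: "rGamma z \<noteq> 0"
    using assms by (simp add: rGamma_eq_zero_iff)
  have "(\<lambda>n. rGamma z / rGamma_series z n * (z * inverse (of_nat n) + 1)) \<longlonglongrightarrow>
          rGamma z / rGamma z * (z * 0 + 1)"
    by (intro tendsto_intros nz lim_inverse_n)
  hence lim: "(\<lambda>n. rGamma z / rGamma_series z n * (z * inverse (of_nat n) + 1)) \<longlonglongrightarrow> 1"
    using nz by simp
  show ?thesis
  proof (rule Lim_transform_eventually[OF lim], use eventually_gt_at_top[of 0] in eventually_elim)
    case (elim n)
    have zn: "z + of_nat n \<noteq> 0"
      using assms by (metis add_eq_0_iff2 minus_of_nat_in_nonpos_Ints)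
    have poch: "pochhammer z n \<noteq> 0"
      using assms by (auto dest: pochhammer_eq_0_imp_nonpos_Int)
    have pw: "of_nat n powr z = exp (z * of_real (ln (of_nat n)))"
      using elim by (simp add: powr_def Ln_of_nat)
    have "rGamma z / rGamma_series z n =
            rGamma (z + of_nat n) * fact n * of_nat n powr z / (z + of_nat n)"
      unfolding rGamma_series_def pw pochhammer_rGamma[of z n]
      using poch zn by (simp add: pochhammer_rec')
    thus ?case
      using elim zn by (simp add: powr_diff field_simps)
  qed
qed

text \<open>
  At a zero of \<open>rGamma\<close> the product formula carries no information. However, the limit for \<open>w + 1\<close>
  implies the one for \<open>w\<close>, since the recurrence only contributes the factor
  \<open>(w + n) / n\<close>; descending from \<open>1\<close> reaches every nonpositive integer.
\<close>

lemma rGamma_shift_asymp: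
  fixes z :: complex
  shows "(\<lambda>n. rGamma (z + of_nat n) * fact n * of_nat n powr (z - 1)) \<longlonglongrightarrow> 1"
proof (cases "z \<in> \<int>\<^sub>\<le>\<^sub>0")
  case True
  then obtain m where m: "z = - of_nat m"
    by (auto elim: nonpos_Ints_cases')
  have step: "(\<lambda>n. rGamma (w + of_nat n) * fact n * of_nat n powr (w - 1)) \<longlonglongrightarrow> 1"
    if "(\<lambda>n. rGamma (w + 1 + of_nat n) * fact n * of_nat n powr (w + 1 - 1)) \<longlonglongrightarrow> 1"
    for w :: complex
  proof -
    have "(\<lambda>n. (rGamma (w + 1 + of_nat n) * fact n * of_nat n powr (w + 1 - 1)) *
             (w * inverse (of_nat n) + 1)) \<longlonglongrightarrow> 1 * (w * 0 + 1)"
      by (intro tendsto_intros lim_inverse_n that)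
    hence lim: "(\<lambda>n. (rGamma (w + 1 + of_nat n) * fact n * of_nat n powr (w + 1 - 1)) *
             (w * inverse (of_nat n) + 1)) \<longlonglongrightarrow> 1" by simp
    show ?thesis
    proof (rule Lim_transform_eventually[OF lim], use eventually_gt_at_top[of 0] in eventually_elim)
      case (elim n)
      have "rGamma (w + of_nat n) = (w + of_nat n) * rGamma (w + 1 + of_nat n)"
        using rGamma_plus1[of "w + of_nat n"] by (simp add: add_ac)
      thus ?case
        using elim by (simp add: powr_diff field_simps)
    qed
  qed
  have "(\<lambda>n. rGamma (1 - of_nat k + of_nat n) * fact n * of_nat n powr (1 - of_nat k - 1 :: complex))
          \<longlonglongrightarrow> 1" for k
  proof (induction k)
    case 0
    show ?case
      using rGamma_shift_asymp_regular[of 1] by simp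
  next
    case (Suc k)
    show ?case
      using step[of "1 - of_nat (Suc k)"] Suc.IH by simp
  qed
  from this[of "Suc m"] show ?thesis
    by (simp add: m)
qed (rule rGamma_shift_asymp_regular)

lemma Gamma_ratio_asymp:
  fixes a b :: complex
  shows "(\<lambda>n. Gamma (a + of_nat n) * rGamma (b + of_nat n) * of_nat n powr (b - a)) \<longlonglongrightarrow> 1"
proof -
  have "(\<lambda>n. (rGamma (b + of_nat n) * fact n * of_nat n powr (b - 1)) /
             (rGamma (a + of_nat n) * fact n * of_nat n powr (a - 1))) \<longlonglongrightarrow> 1 / 1"
    by (intro tendsto_divide rGamma_shift_asymp) simp
  hence lim: "(\<lambda>n. (rGamma (b + of_nat n) * fact n * of_nat n powr (b - 1)) /
             (rGamma (a + of_nat n) * fact n * of_nat n powr (a - 1))) \<longlonglongrightarrow> 1" by simp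
  show ?thesis
    by (rule Lim_transform_eventually[OF lim], use eventually_gt_at_top[of 0] in eventually_elim)
       (simp add: Gamma_def powr_diff field_simps)
qed

lemma pochhammer_over_fact_asymp:
  fixes z :: complex
  shows "(\<lambda>n. pochhammer z n / fact n * of_nat n powr (1 - z)) \<longlonglongrightarrow> rGamma z"
proof -
  let ?R = "\<lambda>n. rGamma (z + of_nat n) * fact n * of_nat n powr (z - 1)"
  have "(\<lambda>n. rGamma z / ?R n) \<longlonglongrightarrow> rGamma z / 1"
    by (intro tendsto_divide rGamma_shift_asymp tendsto_const) simp
  hence lim: "(\<lambda>n. rGamma z / ?R n) \<longlonglongrightarrow> rGamma z" by simp
  have "eventually (\<lambda>n. ?R n \<noteq> 0) sequentially"
    by (rule tendsto_imp_eventually_ne[OF rGamma_shift_asymp]) simp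
  show ?thesis
  proof (rule Lim_transform_eventually[OF lim], 
      use eventually_gt_at_top[of 0] \<open>eventually (\<lambda>n. ?R n \<noteq> 0) sequentially\<close> in eventually_elim)
    case (elim n)
    thus ?case
      using pochhammer_rGamma[of z n] by (simp add: powr_diff field_simps)
  qed
qed

definition S_coeff :: "complex \<Rightarrow> complex \<Rightarrow> nat \<Rightarrow> complex" where
  "S_coeff \<nu> \<mu> k = Gamma (\<nu> + \<mu> + of_nat k + 1) * rGamma (\<nu> + of_nat k + 3/2)
     * (pochhammer (\<mu> + 1/2) k / fact k)"

definition S_sine :: "complex \<Rightarrow> real \<Rightarrow> nat \<Rightarrow> complex" where
  "S_sine c \<theta> k = sin ((c + 2 * of_nat k + 1) * of_real \<theta>)"

lemma S_term_eq: "S_term \<nu> \<mu> \<theta> k = S_coeff \<nu> \<mu> k * S_sine (\<nu> + \<mu>) \<theta> k"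
  by (simp add: S_term_def S_coeff_def S_sine_def)

text \<open>
  The Gamma ratio and the Pochhammer quotient both grow like \<open>n powr (\<mu> - 1/2)\<close>; the parameter
  \<open>\<nu>\<close> cancels in the exponent of the former.
\<close>

lemma S_coeff_asymp:
  "(\<lambda>n. S_coeff \<nu> \<mu> n * of_nat n powr (1 - 2 * \<mu>)) \<longlonglongrightarrow> rGamma (\<mu> + 1/2)"
proof -
  have "(\<lambda>n. (Gamma ((\<nu> + \<mu> + 1) + of_nat n) * rGamma ((\<nu> + 3/2) + of_nat n) *
               of_nat n powr ((\<nu> + 3/2) - (\<nu> + \<mu> + 1))) *
             (pochhammer (\<mu> + 1/2) n / fact n * of_nat n powr (1 - (\<mu> + 1/2))))
          \<longlonglongrightarrow> 1 * rGamma (\<mu> + 1/2)"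
    by (intro tendsto_mult Gamma_ratio_asymp pochhammer_over_fact_asymp)
  moreover have pw: "of_nat n powr ((\<nu> + 3/2) - (\<nu> + \<mu> + 1)) * of_nat n powr (1 - (\<mu> + 1/2)) =
                 of_nat n powr (1 - 2 * \<mu>)" for n
    by (simp flip: powr_add)
  moreover have "(Gamma ((\<nu> + \<mu> + 1) + of_nat n) * rGamma ((\<nu> + 3/2) + of_nat n) *
            of_nat n powr ((\<nu> + 3/2) - (\<nu> + \<mu> + 1))) *
          (pochhammer (\<mu> + 1/2) n / fact n * of_nat n powr (1 - (\<mu> + 1/2))) =
         S_coeff \<nu> \<mu> n * of_nat n powr (1 - 2 * \<mu>)" for n
  proof -
    have e: "\<nu> + \<mu> + of_nat n + 1 = (\<nu> + \<mu> + 1) + of_nat n"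
            "\<nu> + of_nat n + 3/2 = (\<nu> + 3/2) + of_nat n"
      by simp_all
    show ?thesis
      unfolding S_coeff_def e pw[symmetric] by (simp only: mult_ac)
  qed
  ultimately show ?thesis
    by simp
qed

lemma norm_S_coeff_asymp:
  "(\<lambda>n. norm (S_coeff \<nu> \<mu> n) * of_nat n powr (1 - 2 * Re \<mu>)) \<longlonglongrightarrow> norm (rGamma (\<mu> + 1/2))"
  using tendsto_norm[OF S_coeff_asymp[of \<nu> \<mu>]]
  by (simp add: norm_mult norm_of_nat_powr)

text \<open>
  The coefficients satisfy a hypergeometric recurrence whose ratio is
  \<open>1 + (2\<mu> - 1) / n + O(1 / n\<^sup>2)\<close>, so a difference gains a factor \<open>1 / n\<close> over the coefficient.
  The excluded values of \<open>\<nu> + \<mu>\<close> are those for which the recurrence would meet a pole of \<open>\<Gamma>\<close>.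
\<close>

lemma S_coeff_diff_asymp:
  assumes "\<nu> + \<mu> \<notin> {- of_nat n | n :: nat. n \<ge> 1}"
  shows "(\<lambda>n. (S_coeff \<nu> \<mu> (Suc n) - S_coeff \<nu> \<mu> n) * of_nat n powr (2 - 2 * \<mu>)) \<longlonglongrightarrow>
           (2 * \<mu> - 1) * rGamma (\<mu> + 1/2)"
proof -
  let ?c = "S_coeff \<nu> \<mu>"
  let ?i = "\<lambda>n. inverse (of_nat n) :: complex"
  \<comment> \<open>\<open>r n / n\<close> is the relative increment of the coefficients; \<open>d\<close> is the constant coefficient of
    its numerator. The numerator and the denominator of \<open>r\<close> are divided by powers of \<open>n\<close>, so that its
    limit can be read off.\<close>
  define d where "d = (\<nu> + \<mu> + 1) * (\<mu> + 1/2) - (\<nu> + 3/2)"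
  define r where "r = (\<lambda>n. ((2 * \<mu> - 1) + d * ?i n) / (((\<nu> + 3/2) * ?i n + 1) * (1 * ?i n + 1)))"
  have "r \<longlonglongrightarrow> ((2 * \<mu> - 1) + d * 0) / (((\<nu> + 3/2) * 0 + 1) * (1 * 0 + 1))"
    unfolding r_def by (intro tendsto_intros lim_inverse_n) simp
  hence "(\<lambda>n. r n * (?c n * of_nat n powr (1 - 2 * \<mu>))) \<longlonglongrightarrow> (2 * \<mu> - 1) * rGamma (\<mu> + 1/2)"
    by (intro tendsto_mult S_coeff_asymp) simp
  moreover have "(\<lambda>n. (\<nu> + 3/2) * ?i n + 1) \<longlonglongrightarrow> (\<nu> + 3/2) * 0 + 1"
    by (intro tendsto_intros lim_inverse_n)
  hence "eventually (\<lambda>n. (\<nu> + 3/2) * ?i n + 1 \<noteq> 0) sequentially"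
    by (rule tendsto_imp_eventually_ne) simp
  hence "eventually (\<lambda>n. r n * (?c n * of_nat n powr (1 - 2 * \<mu>)) =
           (?c (Suc n) - ?c n) * of_nat n powr (2 - 2 * \<mu>)) sequentially"
    using eventually_gt_at_top[of 0]
  proof eventually_elim
    case (elim n)
    define x where "x = (of_nat n :: complex)"
    have x: "x \<noteq> 0" "x + 1 \<noteq> 0"
      using elim of_nat_neq_0[of n, where 'a = complex] by (auto simp: x_def add_ac)
    have b: "\<nu> + x + 3/2 \<noteq> 0"
      using elim x(1) by (auto simp: x_def field_simps)
    have a: "\<nu> + \<mu> + x + 1 \<noteq> 0"
    proof
      assume "\<nu> + \<mu> + x + 1 = 0"
      hence "\<nu> + \<mu> = - of_nat (Suc n)"
        unfolding eq_neg_iff_add_eq_0 by (simp add: x_def add_ac)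
      hence "\<exists>m. \<nu> + \<mu> = - of_nat m \<and> m \<ge> 1"
        by (intro exI[of _ "Suc n"]) simp
      with assms show False by blast
    qed
    have G: "Gamma (\<nu> + \<mu> + x + 1 + 1) = (\<nu> + \<mu> + x + 1) * Gamma (\<nu> + \<mu> + x + 1)"
    proof -
      have "Gamma (\<nu> + \<mu> + x + 1 + 1) =
              (\<nu> + \<mu> + x + 1) * inverse ((\<nu> + \<mu> + x + 1) * rGamma (\<nu> + \<mu> + x + 1 + 1))"
        using a by (simp add: Gamma_def)
      thus ?thesis
        by (simp only: rGamma_plus1 Gamma_def)
    qed
    have R: "rGamma (\<nu> + x + 3/2 + 1) = rGamma (\<nu> + x + 3/2) / (\<nu> + x + 3/2)"
      using rGamma_plus1[of "\<nu> + x + 3/2"] b by (simp add: field_simps)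
    have "?c (Suc n) = Gamma (\<nu> + \<mu> + x + 1 + 1) * rGamma (\<nu> + x + 3/2 + 1) *
            (pochhammer (\<mu> + 1/2) n * (\<mu> + 1/2 + x) / ((x + 1) * fact n))"
      by (simp add: S_coeff_def x_def pochhammer_rec' add_ac mult_ac)
    also have "\<dots> = ?c n * ((\<nu> + \<mu> + x + 1) * (\<mu> + 1/2 + x) / ((\<nu> + x + 3/2) * (x + 1)))"
      unfolding G R by (simp add: S_coeff_def x_def mult_ac)
    finally have ratio: "?c (Suc n) - ?c n =
        ?c n * ((\<nu> + \<mu> + x + 1) * (\<mu> + 1/2 + x) / ((\<nu> + x + 3/2) * (x + 1)) - 1)"
      by (simp add: algebra_simps)
    have num: "(\<nu> + \<mu> + x + 1) * (\<mu> + 1/2 + x) - (\<nu> + x + 3/2) * (x + 1) = (2 * \<mu> - 1) * x + d"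
      by (simp add: d_def algebra_simps add_divide_distrib diff_divide_distrib)
    have "(\<nu> + \<mu> + x + 1) * (\<mu> + 1/2 + x) / ((\<nu> + x + 3/2) * (x + 1)) - 1 =
            ((2 * \<mu> - 1) * x + d) / ((\<nu> + x + 3/2) * (x + 1))"
      unfolding num [symmetric] using b x by (simp add: diff_divide_distrib)
    also have "\<dots> = r n * inverse x"
    proof -
      have e: "(2 * \<mu> - 1) * x + d = x * ((2 * \<mu> - 1) + d * inverse x)"
           "\<nu> + x + 3/2 = x * ((\<nu> + 3/2) * inverse x + 1)"
           "x + 1 = x * (1 * inverse x + 1)"
        using x by (simp_all add: field_simps)
      have "x * A / (x * B * (x * C)) = A / (B * C) * inverse x" for A B C
        using x(1) by (simp add: divide_inverse mult_ac)
      thus ?thesis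
        unfolding e r_def x_def[symmetric] .
    qed
    finally have "?c (Suc n) - ?c n = ?c n * (r n * inverse x)"
      unfolding ratio by simp
    moreover have "x powr (2 - 2 * \<mu>) = x * x powr (1 - 2 * \<mu>)"
      using x(1) powr_add[of x 1 "1 - 2 * \<mu>"] by simp
    ultimately show ?case
      using x(1) by (simp add: x_def[symmetric])
  qed
  ultimately show ?thesis
    by (rule Lim_transform_eventually)
qed

lemma S_coeff_lower_bound:
  assumes "0 \<le> Re \<mu>"
  obtains \<delta> where "\<delta> > 0"
    "eventually (\<lambda>n. \<delta> * of_nat n powr (2 * Re \<mu> - 1) \<le> norm (S_coeff \<nu> \<mu> n)) sequentially"
proof -
  define \<delta> where "\<delta> = norm (rGamma (\<mu> + 1/2)) / 2"
  \<comment> \<open>The limit constant does not vanish because \<open>\<mu> + 1/2\<close> lies in the right half plane.\<close>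
  have "\<mu> + 1/2 \<notin> \<int>\<^sub>\<le>\<^sub>0"
    using assms by (auto elim!: nonpos_Ints_cases simp: complex_eq_iff)
  hence "\<delta> > 0"
    by (simp add: \<delta>_def rGamma_eq_zero_iff)
  hence "eventually (\<lambda>n. norm (S_coeff \<nu> \<mu> n) * of_nat n powr (1 - 2 * Re \<mu>) > \<delta>) sequentially"
    by (intro order_tendstoD[OF norm_S_coeff_asymp]) (simp add: \<delta>_def)
  hence "eventually (\<lambda>n. \<delta> * of_nat n powr (2 * Re \<mu> - 1) \<le> norm (S_coeff \<nu> \<mu> n)) sequentially"
    using eventually_gt_at_top[of 0]
    by eventually_elim (auto simp: powr_diff field_simps)
  with \<open>\<delta> > 0\<close> show ?thesis by (rule that)
qed

section \<open>The sine factors\<close>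

lemma norm_sin_add_real_le:
  "norm (sin (z + of_real t)) \<le> norm (sin z) + norm (cos z)" for z :: complex
proof -
  have "norm (sin (z + of_real t)) \<le>
          norm (sin z) * \<bar>cos t\<bar> + norm (cos z) * \<bar>sin t\<bar>"
    unfolding sin_add
    by (rule order_trans[OF norm_triangle_ineq]) (simp add: norm_mult cos_of_real sin_of_real)
  also have "\<dots> \<le> norm (sin z) * 1 + norm (cos z) * 1"
    by (intro add_mono mult_left_mono) auto
  finally show ?thesis by simp
qed

lemma norm_cos_add_real_le:
  "norm (cos (z + of_real t)) \<le> norm (sin z) + norm (cos z)" for z :: complex
  \<comment> \<open>Shifting by a quarter period turns the cosine into a sine and interchanges the two summands.\<close>
  using norm_sin_add_real_le[of "z + of_real (pi/2)" t]
  by (simp add: sin_add cos_add algebra_simps flip: cos_of_real sin_of_real)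

lemma S_sine_bounded: "\<exists>B. \<forall>k. norm (S_sine c \<theta> k) \<le> B"
proof (intro exI allI)
  fix k
  have "(c + 2 * of_nat k + 1) * of_real \<theta> = c * of_real \<theta> + of_real ((2 * real k + 1) * \<theta>)"
    by (simp add: algebra_simps)
  thus "norm (S_sine c \<theta> k) \<le> norm (sin (c * of_real \<theta>)) + norm (cos (c * of_real \<theta>))"
    unfolding S_sine_def using norm_sin_add_real_le by metis
qed

text \<open>
  With \<open>w\<close> the argument of the first sine and \<open>t = 2\<theta>\<close>, the identity
  \<open>e\<^sup>i\<^sup>w sin t = sin (w + t) - e\<^sup>-\<^sup>i\<^sup>t sin w\<close> expresses a quantity of constant modulus by the two
  sines.
\<close>

lemma S_sine_pair_lower_bound:
  "exp (- Im c * \<theta>) * \<bar>sin (2 * \<theta>)\<bar> \<le> norm (S_sine c \<theta> k) + norm (S_sine c \<theta> (Suc k))"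
proof -
  define w where "w = (c + 2 * of_nat k + 1) * of_real \<theta>"
  define t :: complex where "t = of_real (2 * \<theta>)"
  have wt: "(c + 2 * of_nat (Suc k) + 1) * of_real \<theta> = w + t"
    by (simp add: w_def t_def algebra_simps)
  have "exp (\<i> * w) * sin t = sin (w + t) - exp (- (\<i> * t)) * sin w"
    by (simp add: exp_Euler[of w] exp_minus_Euler[of t] sin_add algebra_simps)
  hence "norm (exp (\<i> * w)) * norm (sin t) \<le>
           norm (sin (w + t)) + norm (exp (- (\<i> * t))) * norm (sin w)"
    by (metis norm_mult norm_triangle_ineq4)
  moreover have "norm (exp (\<i> * w)) = exp (- Im c * \<theta>)"
    by (simp add: w_def)
  moreover have "norm (exp (- (\<i> * t))) = 1"
    by (simp add: t_def)
  moreover have "norm (sin t) = \<bar>sin (2 * \<theta>)\<bar>"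
    unfolding t_def sin_of_real by simp
  ultimately show ?thesis
    by (simp only: S_sine_def wt w_def[symmetric])
qed

text \<open>
  The sum of the sines \<open>s\<^sub>k\<close> telescopes after multiplication by \<open>2 sin \<theta>\<close>, because
  \<open>2 sin \<theta> sin w = cos (w - \<theta>) - cos (w + \<theta>)\<close>. A bounded \<open>V\<close> with \<open>V (k + 1) - V k = s\<^sub>k\<close>
  takes the place of the partial sums in Dirichlet's test.
\<close>

lemma S_sine_bounded_primitive:
  assumes "0 < \<theta>" "\<theta> < pi"
  obtains V B where "\<And>k. S_sine c \<theta> k = V (Suc k) - V k" "\<And>k. norm (V k) \<le> B"
proof
  define a where "a = c * of_real \<theta>"
  define V where "V = (\<lambda>k. - cos (a + of_real (2 * real k * \<theta>)) / (2 * sin (of_real \<theta>)))"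
  have s: "sin (of_real \<theta> :: complex) \<noteq> 0"
    using sin_gt_zero[OF assms] by (simp add: sin_of_real)
  show "S_sine c \<theta> k = V (Suc k) - V k" for k
  proof -
    define w where "w = (c + 2 * of_nat k + 1) * complex_of_real \<theta>"
    have 1: "a + of_real (2 * real k * \<theta>) = w - of_real \<theta>"
         "a + of_real (2 * real (Suc k) * \<theta>) = w + of_real \<theta>"
      by (simp_all add: a_def w_def algebra_simps)
    show ?thesis
      unfolding V_def 1 S_sine_def w_def[symmetric]
      using s by (simp add: cos_add cos_diff field_simps)
  qed
  show "norm (V k) \<le> (norm (sin a) + norm (cos a)) / norm (2 * sin (complex_of_real \<theta>))" for k
    unfolding V_def norm_divide norm_minus_cancel
    by (intro divide_right_mono norm_cos_add_real_le) auto
qed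

lemma sin_double_nonzero:
  fixes \<theta> :: real
  assumes "0 < \<theta>" "\<theta> < pi" "\<theta> \<noteq> pi/2"
  shows "sin (2 * \<theta>) \<noteq> 0"
proof (cases "\<theta> < pi/2")
  case True
  thus ?thesis using assms sin_gt_zero[of "2 * \<theta>"] by simp
next
  case False
  thus ?thesis using assms sin_lt_zero[of "2 * \<theta>"] by simp
qed

section \<open>Summability criteria\<close>

text \<open>
  Dirichlet's test with bounded variation in place of monotonicity. Summation by parts writes the
  term as the increment of \<open>c n * V n\<close>, which telescopes, minus \<open>(c (n + 1) - c n) * V (n + 1)\<close>,
  which is absolutely summable.
\<close>

lemma summable_mult_bounded_primitive:
  fixes c V :: "nat \<Rightarrow> complex"
  assumes "c \<longlonglongrightarrow> 0" and "summable (\<lambda>n. norm (c (Suc n) - c n))"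
    and "\<And>n. norm (V n) \<le> B"
  shows "summable (\<lambda>n. c n * (V (Suc n) - V n))"
proof -
  have "(\<lambda>n. c n * V n) \<longlonglongrightarrow> 0"
    using assms(1,3) by (intro lim_null_mult_right_bounded[where B = B]) auto
  hence "summable (\<lambda>n. c (Suc n) * V (Suc n) - c n * V n)"
    by (rule telescope_summable)
  moreover have "summable (\<lambda>n. (c (Suc n) - c n) * V (Suc n))"
    by (rule summable_comparison_test'[OF summable_mult2[OF assms(2), of B]])
       (auto simp: norm_mult intro!: mult_left_mono assms(3))
  ultimately have "summable (\<lambda>n. (c (Suc n) * V (Suc n) - c n * V n) -
                                  (c (Suc n) - c n) * V (Suc n))"
    by (rule summable_diff)
  thus ?thesis by (simp add: algebra_simps)
qed

lemma summable_norm_if_powr_asymp: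
  fixes f :: "nat \<Rightarrow> complex"
  assumes "(\<lambda>n. f n * of_nat n powr p) \<longlonglongrightarrow> L" and "Re p > 1"
  shows "summable (\<lambda>n. norm (f n))"
proof -
  have "eventually (\<lambda>n. norm (f n * of_nat n powr p) < norm L + 1) sequentially"
    using tendsto_norm[OF assms(1)] by (rule order_tendstoD) simp
  hence "eventually (\<lambda>n. norm (norm (f n)) \<le> (norm L + 1) * of_nat n powr (- Re p)) sequentially"
    using eventually_gt_at_top[of 0]
    by eventually_elim (auto simp: norm_mult norm_of_nat_powr powr_minus field_simps)
  thus ?thesis
    by (rule summable_comparison_test_ev)
       (use assms(2) in \<open>auto intro!: summable_mult simp: summable_real_powr_iff\<close>)
qed

section \<open>The three regimes of convergence\<close>

theorem theorem2:
  fixes \<theta> :: real and \<nu> \<mu> :: complex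
  assumes "0 < \<theta>" and "\<theta> < pi"
    and "\<nu> + \<mu> \<notin> {- of_nat n | n :: nat. n \<ge> 1}"
  shows "(Re \<mu> < 0 \<longrightarrow> summable (\<lambda>k. norm (S_term \<nu> \<mu> \<theta> k)))
    \<and> (0 \<le> Re \<mu> \<and> Re \<mu> < 1/2 \<longrightarrow>
         summable (S_term \<nu> \<mu> \<theta>)
         \<and> (\<theta> \<noteq> pi/2 \<longrightarrow> \<not> summable (\<lambda>k. norm (S_term \<nu> \<mu> \<theta> k))))
    \<and> (Re \<mu> \<ge> 1/2 \<and> \<theta> \<noteq> pi/2 \<longrightarrow> \<not> summable (S_term \<nu> \<mu> \<theta>))"
proof (intro conjI impI; (elim conjE)?)
  let ?c = "S_coeff \<nu> \<mu>" and ?s = "S_sine (\<nu> + \<mu>) \<theta>"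
  let ?\<epsilon> = "exp (- Im (\<nu> + \<mu>) * \<theta>) * \<bar>sin (2 * \<theta>)\<bar>"
  show "summable (\<lambda>k. norm (S_term \<nu> \<mu> \<theta> k))" if "Re \<mu> < 0"
  proof -
    obtain B where B: "\<And>k. norm (?s k) \<le> B"
      using S_sine_bounded by blast
    have "summable (\<lambda>k. norm (?c k))"
      using that by (intro summable_norm_if_powr_asymp[OF S_coeff_asymp]) simp
    from summable_mult2[OF this, of B] show ?thesis
      by (rule summable_comparison_test')
         (auto simp: S_term_eq norm_mult intro!: mult_left_mono B)
  qed
  show "summable (S_term \<nu> \<mu> \<theta>)" if "Re \<mu> < 1/2"
  proof -
    obtain V B where V: "\<And>k. ?s k = V (Suc k) - V k" "\<And>k. norm (V k) \<le> B"
      using S_sine_bounded_primitive assms(1,2) by blast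
    have "(\<lambda>n. real n powr (2 * Re \<mu> - 1)) \<longlonglongrightarrow> 0"
      using that by (intro tendsto_neg_powr filterlim_real_sequentially) auto
    hence "(\<lambda>n. (norm (?c n) * of_nat n powr (1 - 2 * Re \<mu>)) * real n powr (2 * Re \<mu> - 1))
            \<longlonglongrightarrow> norm (rGamma (\<mu> + 1/2)) * 0"
      by (intro tendsto_mult norm_S_coeff_asymp)
    hence lim: "(\<lambda>n. (norm (?c n) * of_nat n powr (1 - 2 * Re \<mu>)) * real n powr (2 * Re \<mu> - 1))
            \<longlonglongrightarrow> 0" by simp
    have "(\<lambda>n. norm (?c n)) \<longlonglongrightarrow> 0"
      by (rule Lim_transform_eventually[OF lim],
          use eventually_gt_at_top[of 0] in eventually_elim) (simp add: powr_diff)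
    hence "?c \<longlonglongrightarrow> 0"
      by (rule tendsto_norm_zero_cancel)
    moreover have "summable (\<lambda>n. norm (?c (Suc n) - ?c n))"
      using that by (intro summable_norm_if_powr_asymp[OF S_coeff_diff_asymp[OF assms(3)]]) simp
    ultimately show ?thesis
      using summable_mult_bounded_primitive[of ?c V B] V
      by (simp add: S_term_eq[abs_def])
  qed
  show "\<not> summable (\<lambda>k. norm (S_term \<nu> \<mu> \<theta> k))" if re: "0 \<le> Re \<mu>" and \<theta>: "\<theta> \<noteq> pi/2"
  proof
    assume sum: "summable (\<lambda>k. norm (S_term \<nu> \<mu> \<theta> k))"
    have eps: "?\<epsilon> > 0"
      using sin_double_nonzero[OF assms(1,2) \<theta>] by simp
    obtain \<delta> where \<delta>: "\<delta> > 0"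
      "eventually (\<lambda>n. \<delta> * of_nat n powr (2 * Re \<mu> - 1) \<le> norm (?c n)) sequentially"
      by (rule S_coeff_lower_bound[OF re])
    have low: "eventually (\<lambda>n. \<delta> / n * norm (?s n) \<le> norm (S_term \<nu> \<mu> \<theta> n)) sequentially"
      using \<delta>(2) eventually_gt_at_top[of 0]
    proof eventually_elim
      case (elim n)
      have "real n powr (-1) \<le> real n powr (2 * Re \<mu> - 1)"
        using re elim by (intro powr_mono) auto
      hence "\<delta> / n \<le> \<delta> * real n powr (2 * Re \<mu> - 1)"
        using \<delta>(1) elim by (simp add: powr_minus field_simps)
      with elim have "\<delta> / n \<le> norm (?c n)" by linarith
      thus ?case
        unfolding S_term_eq norm_mult by (intro mult_right_mono) auto
    qed
    \<comment> \<open>Pairing neighbouring terms makes the lower bound for two consecutive sines applicable.\<close>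
    have "eventually (\<lambda>n. norm (\<delta> * ?\<epsilon> * inverse (real (Suc n))) \<le> 
         norm (S_term \<nu> \<mu> \<theta> n) + norm (S_term \<nu> \<mu> \<theta> (Suc n))) sequentially"
      using low eventually_sequentially_Suc[THEN iffD2, OF low] eventually_gt_at_top[of 0]
    proof eventually_elim
      case (elim n)
      have "\<delta> * ?\<epsilon> * inverse (real (Suc n)) = \<delta> / Suc n * ?\<epsilon>"
        by (simp add: divide_inverse)
      also have "\<dots> \<le> \<delta> / Suc n * (norm (?s n) + norm (?s (Suc n)))"
        using \<delta>(1) by (intro mult_left_mono S_sine_pair_lower_bound) auto
      also have "\<dots> = \<delta> / Suc n * norm (?s n) + \<delta> / Suc n * norm (?s (Suc n))"
        by (rule distrib_left)
      also have "\<dots> \<le> \<delta> / n * norm (?s n) + \<delta> / Suc n * norm (?s (Suc n))"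
        using \<delta>(1) elim(3) by (intro add_mono mult_right_mono divide_left_mono) auto
      finally show ?case
        using elim(1,2) \<delta>(1) eps by simp
    qed
    moreover have "summable (\<lambda>n. norm (S_term \<nu> \<mu> \<theta> n) + norm (S_term \<nu> \<mu> \<theta> (Suc n)))"
      using sum summable_Suc_iff[of "\<lambda>n. norm (S_term \<nu> \<mu> \<theta> n)"] by (intro summable_add) simp_all
    ultimately have "summable (\<lambda>n. \<delta> * ?\<epsilon> * inverse (real (Suc n)))"
      by (rule summable_comparison_test_ev)
    hence "summable (\<lambda>n. inverse (real (Suc n)))"
      using \<delta>(1) eps by (subst (asm) summable_cmult_iff) auto
    thus False
      using not_summable_harmonic[where 'a = real] summable_Suc_iff[of "\<lambda>n. inverse (real n)"]
      by simp
  qed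
  show "\<not> summable (S_term \<nu> \<mu> \<theta>)" if re: "1/2 \<le> Re \<mu>" and \<theta>: "\<theta> \<noteq> pi/2"
  proof
    assume "summable (S_term \<nu> \<mu> \<theta>)"
    hence term0: "(\<lambda>n. norm (S_term \<nu> \<mu> \<theta> n)) \<longlonglongrightarrow> 0"
      by (intro tendsto_norm_zero summable_LIMSEQ_zero)
    have eps: "?\<epsilon> > 0"
      using sin_double_nonzero[OF assms(1,2) \<theta>] by simp
    obtain \<delta> where \<delta>: "\<delta> > 0"
      "eventually (\<lambda>n. \<delta> * of_nat n powr (2 * Re \<mu> - 1) \<le> norm (?c n)) sequentially"
      by (rule S_coeff_lower_bound[of \<mu>]) (use re in auto)
    have "eventually (\<lambda>n. norm (norm (?s n)) \<le> norm (S_term \<nu> \<mu> \<theta> n) / \<delta>) sequentially"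
      using \<delta>(2) eventually_gt_at_top[of 0]
    proof eventually_elim
      case (elim n)
      have "\<delta> * 1 \<le> \<delta> * real n powr (2 * Re \<mu> - 1)"
        using \<delta>(1) elim re by (intro mult_left_mono ge_one_powr_ge_zero) auto
      with elim have "\<delta> \<le> norm (?c n)" by linarith
      hence "\<delta> * norm (?s n) \<le> norm (S_term \<nu> \<mu> \<theta> n)"
        by (simp add: S_term_eq norm_mult mult_right_mono)
      thus ?case
        using \<delta>(1) by (simp add: field_simps)
    qed
    moreover have "(\<lambda>n. norm (S_term \<nu> \<mu> \<theta> n) / \<delta>) \<longlonglongrightarrow> 0"
      using tendsto_divide_zero[OF term0] .
    ultimately have "(\<lambda>n. norm (?s n)) \<longlonglongrightarrow> 0"
      by (rule Lim_null_comparison)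
    hence "(\<lambda>n. norm (?s n) + norm (?s (Suc n))) \<longlonglongrightarrow> 0 + 0"
      by (intro tendsto_add LIMSEQ_Suc)
    hence "?\<epsilon> \<le> 0 + 0"
      by (rule tendsto_lowerbound)
         (intro always_eventually allI S_sine_pair_lower_bound, rule trivial_limit_sequentially)
    with eps show False by simp
  qed
qed

end
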